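(* Let $T$ be a tree with maximum degree $\Delta$. Then $A^*(T)\ge \Delta(\Delta^2-1)$, with equality if and only if $T$ is isomorphic to either a path or a tree containing only one vertex of degree greater than $2$.
   Context: All graphs are simple and finite. For a graph $G$ with edge set $E(G)$, $d_u$ denotes the degree of the vertex $u$ in $G$. The modified Albertson index of $G$ is $A^*(G)=\sum_{uv\in E(G)} |(d_u)^2-(d_v)^2|$. *)

theory Defs
  imports "Graph_Theory.Graph_Theory"
begin

text \<open>
  A finite simple graph is a \<^locale>\<open>pair_graph\<close>: finite vertex set, and a symmetric irreflexive
  arc set, so that every undirected edge \<open>uv\<close> is represented by the two arcs \<open>(u, v)\<close> and \<open>(v, u)\<close>.
\<close>

definition degree :: "'a pair_pre_digraph \<Rightarrow> 'a \<Rightarrow> nat" where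
  "degree G v = out_degree (with_proj G) v"

definition max_degree :: "'a pair_pre_digraph \<Rightarrow> nat" where
  "max_degree G = Max (degree G ` pverts G)"

definition edges :: "'a pair_pre_digraph \<Rightarrow> 'a set set" where
  "edges G = {{u, v} | u v. (u, v) \<in> parcs G}"

text \<open>
  The library predicates \<^const>\<open>forest\<close> and \<^const>\<open>tree\<close> count \<open>a, b, a\<close> as a cycle and hence fail for
  every symmetric digraph that has an arc. As the vertices of a \<^const>\<open>pre_digraph.cycle\<close> are
  distinct, excluding length 2 leaves exactly the cycles of the undirected graph.
\<close>

definition undirected_tree :: "'a pair_pre_digraph \<Rightarrow> bool" where
  "undirected_tree G \<longleftrightarrow> pair_graph G \<and> connected (with_proj G) \<and>
     \<not> (\<exists>p. pre_digraph.cycle (with_proj G) p \<and> length p \<ge> 3)"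

definition path_graph :: "nat \<Rightarrow> nat pair_pre_digraph" where
  "path_graph n = \<lparr>pverts = {..<n},
     parcs = {(i, j). i < n \<and> j < n \<and> (j = Suc i \<or> i = Suc j)}\<rparr>"

text \<open>The value at an edge \<open>{u, v}\<close> of a symmetric function of its two endpoints.\<close>

definition on_edge :: "('a \<Rightarrow> 'a \<Rightarrow> 'b) \<Rightarrow> 'a set \<Rightarrow> 'b" where
  "on_edge f e = (THE y. \<exists>u v. e = {u, v} \<and> y = f u v)"

lemma on_edge_insert:
  assumes "\<And>u v. f u v = f v u"
  shows "on_edge f {u, v} = f u v"
  unfolding on_edge_def using assms by (intro the_equality) (auto simp: doubleton_eq_iff)

definition modified_albertson :: "'a pair_pre_digraph \<Rightarrow> int" where
  "modified_albertson G =
     (\<Sum>e\<in>edges G. on_edge (\<lambda>u v. \<bar>(int (degree G u))\<^sup>2 - (int (degree G v))\<^sup>2\<bar>) e)"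

end

theory Submission
  imports Defs
begin

text \<open>
  The identity \<open>a\<^sup>2 = (\<Sum>k<a. 2 * k + 1)\<close> splits the contribution of an edge over thresholds: the edge
  \<open>uv\<close> counts \<open>2 * k + 1\<close> for every \<open>k\<close> with \<open>k\<close> below one of the two degrees but not below the other.
  Hence the index of any graph is \<open>\<Sum>k. (2 * k + 1) * c k\<close>, where \<open>c k\<close> is the number of edges that leave
  the set \<open>S k\<close> of the vertices of degree greater than \<open>k\<close>. As \<open>\<Sum>k=1..<\<Delta>. 2 * k + 1 = \<Delta>\<^sup>2 - 1\<close>, the
  inequality follows once every such cut has at least \<open>\<Delta>\<close> edges, and equality holds just if all these cuts
  have exactly \<open>\<Delta>\<close> edges.

  In a forest a nonempty set \<open>S\<close> of vertices spans at most \<open>card S - 1\<close> edges, so at least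
  \<open>2 + (\<Sum>v\<in>S. deg v - 2)\<close> edges leave it (\<open>cut_ge\<close>). For \<open>1 \<le> k < \<Delta>\<close> all summands over \<open>S k\<close> are
  nonnegative and a vertex \<open>w\<close> of maximum degree contributes \<open>\<Delta> - 2\<close>, which gives \<open>c k \<ge> \<Delta>\<close>
  (\<open>cut_level_ge\<close>). A second vertex of degree greater than 2 adds to the sum for \<open>k = 1\<close> and makes
  the inequality strict (\<open>cut_1_gt\<close>). Conversely, if no vertex other than \<open>w\<close> has degree greater than 2
  then no cut exceeds \<open>\<Delta>\<close> (\<open>cut_le\<close>): for \<open>k \<ge> 2\<close> the set \<open>S k\<close> is just \<open>{w}\<close>, and the edges leaving
  \<open>S 1\<close> end in distinct leaves, of which a connected graph of this kind has at most \<open>\<Delta>\<close>.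

  So equality means that every vertex other than \<open>w\<close> has degree at most 2. If \<open>w\<close> has degree greater
  than 2 it is the only such vertex; otherwise the tree is a path (\<open>path_if_deg_le_2\<close>). Isomorphisms
  preserve degrees, which gives the remaining direction (\<open>path_or_single_branching_iff\<close>).
\<close>

section \<open>Forests\<close>

definition cycle_free :: "'a rel \<Rightarrow> bool" where
  "cycle_free E \<longleftrightarrow> \<not> (\<exists>xs. distinct xs \<and> length xs \<ge> 3 \<and>
     successively (\<lambda>x y. (x, y) \<in> E) xs \<and> (last xs, hd xs) \<in> E)"

text \<open>
  A longest path inside \<open>S\<close> cannot be extended at either end, so the neighbours of its end points lie on it.
\<close>
lemma maximal_path:
  assumes "finite S" "S \<noteq> {}" "sym E"
  obtains xs where "xs \<noteq> []" "distinct xs" "set xs \<subseteq> S" "successively (\<lambda>x y. (x, y) \<in> E) xs"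
    "E `` {hd xs} \<inter> S \<subseteq> set xs" "E `` {last xs} \<inter> S \<subseteq> set xs"
proof -
  define P where "P xs \<longleftrightarrow> xs \<noteq> [] \<and> distinct xs \<and> set xs \<subseteq> S \<and>
    successively (\<lambda>x y. (x, y) \<in> E) xs" for xs
  obtain v where "v \<in> S" using assms by auto
  then have "P [v]" by (simp add: P_def)
  moreover have "length xs < Suc (card S)" if "P xs" for xs
    using that card_mono[of S "set xs"] assms by (auto simp: P_def distinct_card)
  ultimately obtain xs where xs: "P xs" and longest: "\<And>ys. P ys \<Longrightarrow> length ys \<le> length xs"
    using ex_has_greatest_nat[of P "[v]" length "Suc (card S)"] by (metis less_imp_le)
  have "y \<in> set xs" if "(hd xs, y) \<in> E" "y \<in> S" for y
  proof (rule ccontr)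
    assume "y \<notin> set xs"
    with that xs \<open>sym E\<close> have "P (y # xs)"
      by (cases xs) (auto simp: P_def dest: symD)
    from longest[OF this] show False by simp
  qed
  moreover have "y \<in> set xs" if "(last xs, y) \<in> E" "y \<in> S" for y
  proof (rule ccontr)
    assume "y \<notin> set xs"
    with that xs have "P (xs @ [y])"
      by (auto simp: P_def successively_append_iff)
    from longest[OF this] show False by simp
  qed
  ultimately show ?thesis using xs by (intro that[of xs]) (auto simp: P_def)
qed

text \<open>
  Take an end point of a maximal path in \<open>S\<close>. All its neighbours in \<open>S\<close> lie on the path, and one beyond the
  adjacent position would close a cycle.
\<close>
lemma exists_leaf_in_subset:
  assumes "finite S" "S \<noteq> {}" "sym E" "irrefl E" "cycle_free E"
  shows "\<exists>v\<in>S. card (E `` {v} \<inter> S) \<le> 1"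
proof -
  obtain xs where xs: "xs \<noteq> []" "distinct xs" "set xs \<subseteq> S"
    "successively (\<lambda>x y. (x, y) \<in> E) xs" "E `` {hd xs} \<inter> S \<subseteq> set xs"
    using maximal_path[OF assms(1-3)] by metis
  have "y = xs ! 1" if y: "y \<in> E `` {hd xs} \<inter> S" for y
  proof (rule ccontr)
    assume "y \<noteq> xs ! 1"
    obtain j where j: "j < length xs" "y = xs ! j"
      using y xs(5) by (metis in_set_conv_nth subsetD)
    have "j \<noteq> 0" using y j \<open>irrefl E\<close> xs(1) by (metis ImageE IntD1 hd_conv_nth irreflD singletonD)
    with j \<open>y \<noteq> xs ! 1\<close> have "j \<ge> 2" by (cases "j = 1") auto
    let ?c = "take (Suc j) xs"
    have "last ?c = y" using j by (simp add: take_Suc_conv_app_nth)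
    moreover have "hd ?c = hd xs" using xs(1) by simp
    moreover have "(y, hd xs) \<in> E" using y \<open>sym E\<close> by (auto dest: symD)
    moreover have "successively (\<lambda>x y. (x, y) \<in> E) ?c"
      using xs(4) by (metis append_take_drop_id successively_append_iff)
    moreover have "distinct ?c" "length ?c \<ge> 3" using xs j \<open>j \<ge> 2\<close> by auto
    ultimately show False using \<open>cycle_free E\<close> unfolding cycle_free_def by metis
  qed
  then have "E `` {hd xs} \<inter> S \<subseteq> {xs ! 1}" by blast
  then have "card (E `` {hd xs} \<inter> S) \<le> 1" using card_mono[of "{xs ! 1}"] by fastforce
  moreover have "hd xs \<in> S" using xs(1,3) by auto
  ultimately show ?thesis by blast
qed

text \<open>
  Every edge is counted by two arcs, so this is the bound \<open>card S - 1\<close> on the number of edges spanned by \<open>S\<close>.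
  Removing a vertex with at most one neighbour in \<open>S\<close> removes at most two arcs.
\<close>
lemma forest_arcs_le:
  assumes "finite S" "S \<noteq> {}" "sym E" "irrefl E" "cycle_free E"
  shows "card (E \<inter> S \<times> S) + 2 \<le> 2 * card S"
  using assms(1,2)
proof (induction S rule: finite_psubset_induct)
  case (psubset S)
  obtain v where v: "v \<in> S" "card (E `` {v} \<inter> S) \<le> 1"
    using exists_leaf_in_subset psubset assms by metis
  let ?N = "E `` {v} \<inter> S" and ?S' = "S - {v}"
  show ?case
  proof (cases "?S' = {}")
    case True
    then have "S = {v}" using v by auto
    then show ?thesis using \<open>irrefl E\<close> by (auto simp: irrefl_def)
  next
    case False
    have "card (E \<inter> ?S' \<times> ?S') + 2 \<le> 2 * card ?S'"
      using psubset v False by (intro psubset.IH) auto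
    moreover have "E \<inter> S \<times> S \<subseteq> E \<inter> ?S' \<times> ?S' \<union> ({v} \<times> ?N \<union> ?N \<times> {v})"
      using \<open>sym E\<close> by (auto dest: symD)
    then have "card (E \<inter> S \<times> S) \<le> card (E \<inter> ?S' \<times> ?S' \<union> ({v} \<times> ?N \<union> ?N \<times> {v}))"
      using psubset.hyps by (intro card_mono) auto
    moreover have "\<dots> \<le> card (E \<inter> ?S' \<times> ?S') + card ({v} \<times> ?N \<union> ?N \<times> {v})" by (rule card_Un_le)
    moreover have "card ({v} \<times> ?N \<union> ?N \<times> {v}) \<le> card ({v} \<times> ?N) + card (?N \<times> {v})" by (rule card_Un_le)
    moreover have "card ({v} \<times> ?N) + card (?N \<times> {v}) \<le> 2"
      using v(2) by (simp only: card_cartesian_product) simp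
    moreover have "card S = Suc (card ?S')"
      using v psubset.hyps by (metis card_Suc_Diff1)
    ultimately show ?thesis by linarith
  qed
qed

section \<open>Degrees and cuts in a tree\<close>

text \<open>
  Connectedness enters as the existence of an arc that leaves any given nonempty proper subset of the vertices.
\<close>
locale tree_arcs =
  fixes V :: "'a set" and E :: "'a rel"
  assumes finite_V: "finite V" and V_nonempty: "V \<noteq> {}"
    and E_subset: "E \<subseteq> V \<times> V"
    and sym_E: "sym E" and irrefl_E: "irrefl E"
    and leaving_arc: "\<And>A. A \<subset> V \<Longrightarrow> A \<noteq> {} \<Longrightarrow> E \<inter> A \<times> (V - A) \<noteq> {}"
    and no_cycle: "cycle_free E"
begin

abbreviation deg :: "'a \<Rightarrow> nat" where "deg v \<equiv> card (E `` {v})"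

lemma finite_E: "finite E"
  using finite_subset[OF E_subset] finite_V by simp

lemma finite_nbrs: "finite (E `` A)"
  using finite_E by simp

text \<open>
  Growing a vertex set along arcs that leave it adds at least two arcs (one in each direction) per vertex.
\<close>
lemma connected_arcs_ge: "2 * card V \<le> card E + 2"
proof -
  have "\<exists>A \<subseteq> V. card A = Suc k \<and> 2 * Suc k \<le> card (E \<inter> A \<times> A) + 2" if "k < card V" for k
    using that
  proof (induction k)
    case 0
    obtain v where "v \<in> V" using V_nonempty by auto
    then show ?case by (intro exI[of _ "{v}"]) auto
  next
    case (Suc k)
    then obtain A where A: "A \<subseteq> V" "card A = Suc k" "2 * Suc k \<le> card (E \<inter> A \<times> A) + 2"
      by (auto dest: Suc_lessD)
    then have "A \<subset> V" "A \<noteq> {}" using Suc.prems by auto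
    then obtain x y where xy: "(x, y) \<in> E" "x \<in> A" "y \<in> V" "y \<notin> A"
      using leaving_arc by blast
    have "finite A" using A finite_V finite_subset by auto
    let ?B = "insert y A"
    have "(E \<inter> A \<times> A) \<union> {(x, y), (y, x)} \<subseteq> E \<inter> ?B \<times> ?B"
      using xy sym_E by (auto dest: symD)
    then have "card ((E \<inter> A \<times> A) \<union> {(x, y), (y, x)}) \<le> card (E \<inter> ?B \<times> ?B)"
      using finite_E by (intro card_mono) auto
    moreover have "card ((E \<inter> A \<times> A) \<union> {(x, y), (y, x)}) = card (E \<inter> A \<times> A) + 2"
    proof -
      have "(E \<inter> A \<times> A) \<inter> {(x, y), (y, x)} = {}" using xy by blast
      moreover have "card {(x, y), (y, x)} = 2" using xy by (intro card_2_iff[THEN iffD2]) blast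
      ultimately show ?thesis using finite_E card_Un_disjoint[of "E \<inter> A \<times> A" "{(x, y), (y, x)}"] by (metis finite.emptyI finite.insertI finite_Int)
    qed
    ultimately show ?case using A xy \<open>finite A\<close>
      by (intro exI[of _ ?B]) auto
  qed
  from this[of "card V - 1"] V_nonempty finite_V obtain A
    where "A \<subseteq> V" "card A = card V" "2 * card V \<le> card (E \<inter> A \<times> A) + 2"
    by (auto simp: card_gt_0_iff)
  moreover have "card (E \<inter> A \<times> A) \<le> card E" using finite_E by (intro card_mono) auto
  ultimately show ?thesis by linarith
qed

lemma sum_deg: "finite S \<Longrightarrow> (\<Sum>v\<in>S. deg v) = card (E \<inter> S \<times> UNIV)"
proof -
  assume "finite S"
  have "E \<inter> S \<times> UNIV = (SIGMA v:S. E `` {v})" by auto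
  then show ?thesis using \<open>finite S\<close> finite_nbrs by simp
qed

text \<open>
  In fact equality holds, but it is this direction that bounds the number of leaves from above.
\<close>
lemma sum_excess_ge: "(\<Sum>v\<in>V. int (deg v) - 2) \<ge> - 2"
proof -
  have "E \<inter> V \<times> UNIV = E" using E_subset by auto
  then have "(\<Sum>v\<in>V. int (deg v)) = int (card E)"
    using sum_deg[OF finite_V] by (simp flip: of_nat_sum)
  then show ?thesis using connected_arcs_ge by (simp add: sum_subtractf)
qed

lemma deg_pos:
  assumes "v \<in> V" "V \<noteq> {v}"
  shows "deg v > 0"
proof -
  have "{v} \<subset> V" using assms by auto
  then have "E \<inter> {v} \<times> (V - {v}) \<noteq> {}" by (intro leaving_arc) auto
  then show ?thesis using finite_nbrs by (auto simp: card_gt_0_iff)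
qed

text \<open>
  The arcs that start in \<open>S\<close> number \<open>\<Sum>v\<in>S. deg v\<close>, and by the forest bound at most \<open>2 * card S - 2\<close> of
  them stay in \<open>S\<close>.
\<close>
lemma cut_ge:
  assumes "S \<subseteq> V" "S \<noteq> {}"
  shows "int (card (E \<inter> S \<times> - S)) \<ge> 2 + (\<Sum>v\<in>S. int (deg v) - 2)"
proof -
  have fin: "finite S" using assms finite_V finite_subset by auto
  have "E \<inter> S \<times> UNIV = (E \<inter> S \<times> S) \<union> (E \<inter> S \<times> - S)" by auto
  then have "card (E \<inter> S \<times> UNIV) = card (E \<inter> S \<times> S) + card (E \<inter> S \<times> - S)"
    using finite_E by (simp add: card_Un_disjoint disjoint_iff)
  then have "(\<Sum>v\<in>S. int (deg v)) = int (card (E \<inter> S \<times> S)) + int (card (E \<inter> S \<times> - S))"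
    using sum_deg[OF fin] by (simp flip: of_nat_sum)
  moreover have "card (E \<inter> S \<times> S) + 2 \<le> 2 * card S"
    using forest_arcs_le fin assms sym_E irrefl_E no_cycle by blast
  ultimately show ?thesis by (simp add: sum_subtractf)
qed

abbreviation level :: "nat \<Rightarrow> 'a set" where "level k \<equiv> {v. k < deg v}"

abbreviation cut :: "nat \<Rightarrow> int" where "cut k \<equiv> int (card (E \<inter> level k \<times> - level k))"

lemma level_subset: "level k \<subseteq> V"
proof
  fix v assume "v \<in> level k"
  then have "E `` {v} \<noteq> {}" by (metis card.empty mem_Collect_eq not_less_zero)
  then show "v \<in> V" using E_subset by auto
qed

lemma finite_level: "finite (level k)"
  using level_subset finite_V finite_subset by metis

text \<open>
  An end point of an arc has positive degree. So the threshold \<open>0\<close> contributes nothing to the index,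
  which explains why the bound is \<open>\<Delta> * (\<Delta>\<^sup>2 - 1)\<close> and not \<open>\<Delta> * \<Delta>\<^sup>2\<close>.
\<close>
lemma cut_0: "cut 0 = 0"
proof -
  have "v \<in> level 0" if "(u, v) \<in> E" for u v
    using that symD[OF sym_E] finite_nbrs by (auto simp: card_gt_0_iff)
  then have "E \<inter> level 0 \<times> - level 0 = {}" by auto
  then show ?thesis by simp
qed

lemma cut_level_ge:
  assumes "1 \<le> k" "k < deg w"
  shows "cut k \<ge> int (deg w)"
proof -
  have "(\<Sum>v\<in>{w}. int (deg v) - 2) \<le> (\<Sum>v\<in>level k. int (deg v) - 2)"
    using assms finite_level by (intro sum_mono2) auto
  moreover have "level k \<noteq> {}" using assms by auto
  ultimately show ?thesis using cut_ge[OF level_subset, of k] by simp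
qed

text \<open>
  At threshold \<open>1\<close>, \<open>u\<close> contributes the positive amount \<open>deg u - 2\<close> on top of the contribution of \<open>w\<close>.
\<close>
lemma cut_1_gt:
  assumes "u \<noteq> w" "1 < deg w" "2 < deg u"
  shows "cut 1 > int (deg w)"
proof -
  have "(\<Sum>v\<in>{u, w}. int (deg v) - 2) \<le> (\<Sum>v\<in>level 1. int (deg v) - 2)"
    using assms finite_level by (intro sum_mono2) auto
  moreover have "level 1 \<noteq> {}" using assms by auto
  ultimately show ?thesis using cut_ge[OF level_subset, of 1] assms by simp
qed

text \<open>
  For \<open>k \<ge> 2\<close> only arcs that start in \<open>w\<close> can leave the level set. For \<open>k = 1\<close> the cut has at most as many
  arcs as there are leaves. The excesses \<open>deg v - 2\<close> sum to at least \<open>- 2\<close>, while a leaf contributes \<open>- 1\<close>,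
  \<open>w\<close> contributes \<open>deg w - 2\<close> and all other vertices contribute \<open>0\<close>; so there are at most \<open>deg w\<close> leaves.
\<close>
lemma cut_le:
  assumes others: "\<And>u. u \<in> V \<Longrightarrow> u \<noteq> w \<Longrightarrow> deg u \<le> 2" and k: "1 \<le> k" "k < deg w"
  shows "cut k \<le> int (deg w)"
proof (cases "k = 1")
  case False
  have "u = w" if "u \<in> level k" for u
    using others[of u] that level_subset[of k] k False by fastforce
  then have "E \<inter> level k \<times> - level k \<subseteq> {w} \<times> E `` {w}" by auto
  from card_mono[OF _ this] finite_nbrs show ?thesis
    by (simp add: card_cartesian_product)
next
  case True
  let ?L = "{v \<in> V. deg v \<le> 1}"
  have w: "w \<in> level 1" "w \<in> V" using k True level_subset[of 1] by auto
  then have "E `` {w} \<noteq> {}" by (metis card.empty mem_Collect_eq not_less_zero)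
  then have "V \<noteq> {v}" for v
    using E_subset irrefl_E by (auto simp: irrefl_def)
  then have leaf: "deg v = 1" if "v \<in> ?L" for v
    using deg_pos[of v] that by force
  have "(\<Sum>v\<in>?L. deg v) = (\<Sum>v\<in>?L. 1)" by (intro sum.cong refl) (rule leaf)
  then have sum_L: "(\<Sum>v\<in>?L. deg v) = card ?L" by simp
  then have "int (card ?L) + (\<Sum>v\<in>?L. int (deg v) - 2) = 0"
    by (simp add: sum_subtractf flip: of_nat_sum)
  moreover have "(\<Sum>v\<in>V. int (deg v) - 2) = (\<Sum>v\<in>?L. int (deg v) - 2) + (\<Sum>v\<in>level 1. int (deg v) - 2)"
  proof -
    have "?L = V - level 1" by auto
    then show ?thesis by (simp only: sum.subset_diff[OF level_subset finite_V])
  qed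
  moreover have "(\<Sum>v\<in>level 1. int (deg v) - 2) = (\<Sum>v\<in>{w}. int (deg v) - 2)"
  proof (intro sum.mono_neutral_right ballI)
    fix v assume "v \<in> level 1 - {w}"
    with level_subset[of 1] others[of v] have "deg v = 2" by auto
    then show "int (deg v) - 2 = 0" by simp
  qed (use w finite_level in auto)
  moreover note sum_excess_ge
  ultimately have "int (card ?L) \<le> int (deg w)" by simp
  \<comment> \<open>Reversing the arcs of the cut gives arcs that start in leaves, and a leaf starts only one.\<close>
  moreover have "card (E \<inter> level 1 \<times> - level 1) \<le> card (E \<inter> ?L \<times> UNIV)"
  proof (rule card_inj_on_le)
    show "prod.swap ` (E \<inter> level 1 \<times> - level 1) \<subseteq> E \<inter> ?L \<times> UNIV"
      using sym_E E_subset by (auto dest: symD)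
  qed (use finite_E in auto)
  moreover have "card (E \<inter> ?L \<times> UNIV) = card ?L"
    using sum_deg[of ?L] sum_L finite_V by simp
  ultimately show ?thesis using True by simp
qed

section \<open>Trees of maximum degree at most two\<close>

text \<open>
  The predecessor and the successor of \<open>v\<close> on the path already exhaust its two possible neighbours.
\<close>
lemma neighbours_of_inner_path_vertex:
  assumes "v \<in> set xs" "distinct xs" "successively (\<lambda>x y. (x, y) \<in> E) xs" "v \<noteq> hd xs" "v \<noteq> last xs"
    and "deg v \<le> 2"
  shows "E `` {v} \<subseteq> set xs"
proof -
  obtain ys zs where "xs = ys @ v # zs" using assms(1) by (meson split_list)
  moreover from this obtain a ys' b zs' where "ys = ys' @ [a]" "zs = b # zs'"
    using assms(4,5) by (cases ys rule: rev_cases; cases zs) auto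
  ultimately have xs: "xs = ys' @ a # v # b # zs'" by simp
  then have ab: "{a, b} \<subseteq> E `` {v}" "a \<noteq> b"
    using assms(2,3) sym_E by (auto simp: successively_append_iff dest: symD)
  then have "{a, b} = E `` {v}"
    using finite_nbrs \<open>deg v \<le> 2\<close> by (intro card_seteq) auto
  then show ?thesis using xs by auto
qed

text \<open>
  A maximal path has no arc to the outside: its end points by maximality, its inner vertices by the degree
  bound. So it spans the tree. Its \<open>2 * (card V - 1)\<close> arcs are as many as a forest on \<open>V\<close> can have, so
  they are all the arcs.
\<close>
lemma path_if_deg_le_2:
  assumes "\<And>v. v \<in> V \<Longrightarrow> deg v \<le> 2"
  obtains xs where "distinct xs" "set xs = V"
    "E = {(xs ! i, xs ! j) | i j. i < length xs \<and> j < length xs \<and> (j = Suc i \<or> i = Suc j)}"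
proof -
  obtain xs where xs: "xs \<noteq> []" "distinct xs" "set xs \<subseteq> V" "successively (\<lambda>x y. (x, y) \<in> E) xs"
    "E `` {hd xs} \<inter> V \<subseteq> set xs" "E `` {last xs} \<inter> V \<subseteq> set xs"
    using maximal_path[OF finite_V V_nonempty sym_E] by metis
  have "set xs = V"
  proof (rule ccontr)
    assume "set xs \<noteq> V"
    then have "E \<inter> set xs \<times> (V - set xs) \<noteq> {}" using xs by (intro leaving_arc) auto
    then obtain x y where "(x, y) \<in> E" "x \<in> set xs" "y \<in> V" "y \<notin> set xs" by auto
    then show False
      using xs neighbours_of_inner_path_vertex[of x xs] assms[of x] by (cases "x = hd xs \<or> x = last xs") auto
  qed
  let ?n = "length xs"
  define P where "P = {(i, j). i < ?n \<and> j < ?n \<and> (j = Suc i \<or> i = Suc j)}"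
  let ?f = "\<lambda>(i, j). (xs ! i, xs ! j)"
  have inj: "inj_on ?f P"
    using \<open>distinct xs\<close> by (auto simp: inj_on_def P_def nth_eq_iff_index_eq)
  have "?f ` P \<subseteq> E"
    using xs(4) sym_E by (auto simp: P_def successively_conv_nth dest: symD)
  moreover have "card P = 2 * (?n - 1)"
  proof -
    have "P = (\<lambda>i. (i, Suc i)) ` {..<?n - 1} \<union> (\<lambda>i. (Suc i, i)) ` {..<?n - 1}"
      by (auto simp: P_def)
    moreover have "card ((\<lambda>i. (i, Suc i)) ` {..<?n - 1} \<union> (\<lambda>i. (Suc i, i)) ` {..<?n - 1}) =
      card ((\<lambda>i. (i, Suc i)) ` {..<?n - 1}) + card ((\<lambda>i. (Suc i, i)) ` {..<?n - 1})"
      by (intro card_Un_disjoint) auto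
    ultimately show ?thesis by (simp add: card_image inj_on_def)
  qed
  then have "card (?f ` P) = 2 * (?n - 1)" using inj by (simp add: card_image)
  moreover have "card E \<le> 2 * (?n - 1)"
  proof -
    have "card (E \<inter> V \<times> V) + 2 \<le> 2 * card V"
      using forest_arcs_le finite_V V_nonempty sym_E irrefl_E no_cycle by blast
    moreover have "E \<inter> V \<times> V = E" using E_subset by auto
    moreover have "card V = ?n" using \<open>set xs = V\<close> \<open>distinct xs\<close> distinct_card by fastforce
    ultimately show ?thesis by simp
  qed
  ultimately have "?f ` P = E" using finite_E by (metis card_seteq)
  then have "E = {(xs ! i, xs ! j) | i j. i < ?n \<and> j < ?n \<and> (j = Suc i \<or> i = Suc j)}"
    unfolding P_def by force
  with that \<open>set xs = V\<close> \<open>distinct xs\<close> show ?thesis by blast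
qed

section \<open>The weighted sum of the cuts\<close>

text \<open>
  Each cut is compared with its lower bound \<open>D\<close>. Both sides are sums over \<open>1 \<le> k < deg w\<close> with positive
  weights, so the sums agree only if no cut exceeds \<open>D\<close>.
\<close>
lemma weighted_cuts:
  assumes w: "w \<in> V" and max: "\<And>v. v \<in> V \<Longrightarrow> deg v \<le> deg w"
  defines "A \<equiv> \<Sum>k<deg w. int (2 * k + 1) * cut k" and "D \<equiv> int (deg w)"
  shows "A \<ge> D * (D\<^sup>2 - 1)"
    and "A = D * (D\<^sup>2 - 1) \<longleftrightarrow> (\<forall>u\<in>V. u \<noteq> w \<longrightarrow> deg u \<le> 2)"
proof -
  have odd_sum: "(\<Sum>k\<in>{1..<m}. int (2 * k + 1)) = (int m)\<^sup>2 - 1" if "m > 0" for m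
    using that by (induction m rule: nat_induct_non_zero) (auto simp: power2_eq_square algebra_simps)
  let ?K = "{1..<deg w}"
  have A: "A = (\<Sum>k\<in>?K. int (2 * k + 1) * cut k)"
    unfolding A_def
  proof (intro sum.mono_neutral_right ballI)
    fix k assume "k \<in> {..<deg w} - ?K"
    then have "k = 0" by auto
    then show "int (2 * k + 1) * cut k = 0" by (simp only: cut_0 mult_zero_right)
  qed auto
  have target: "D * (D\<^sup>2 - 1) = (\<Sum>k\<in>?K. int (2 * k + 1) * D)"
  proof (cases "deg w = 0")
    case False
    then have "D * (D\<^sup>2 - 1) = (\<Sum>k\<in>?K. int (2 * k + 1)) * D"
      using odd_sum[of "deg w"] by (simp only: D_def mult.commute neq0_conv)
    then show ?thesis by (simp only: sum_distrib_right)
  qed (simp add: D_def)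
  have ge: "int (2 * k + 1) * D \<le> int (2 * k + 1) * cut k" if "k \<in> ?K" for k
    using that cut_level_ge[of k w] unfolding D_def by (intro mult_left_mono) auto
  show "A \<ge> D * (D\<^sup>2 - 1)"
    unfolding A target by (rule sum_mono) (rule ge)
  show "A = D * (D\<^sup>2 - 1) \<longleftrightarrow> (\<forall>u\<in>V. u \<noteq> w \<longrightarrow> deg u \<le> 2)"
  proof
    assume eq: "A = D * (D\<^sup>2 - 1)"
    show "\<forall>u\<in>V. u \<noteq> w \<longrightarrow> deg u \<le> 2"
    proof (intro ballI impI, rule ccontr)
      fix u assume u: "u \<in> V" "u \<noteq> w" "\<not> deg u \<le> 2"
      then have one: "1 < deg w" using max[of u] by linarith
      then have "D < cut 1" using cut_1_gt[of u w] u unfolding D_def by simp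
      then have "D * (D\<^sup>2 - 1) < A"
        unfolding A target using ge one by (intro sum_strict_mono_ex1) (auto intro!: bexI[of _ 1])
      with eq show False by simp
    qed
  next
    assume others: "\<forall>u\<in>V. u \<noteq> w \<longrightarrow> deg u \<le> 2"
    have "cut k = D" if "k \<in> ?K" for k
      using that cut_le[of w k] cut_level_ge[of k w] others unfolding D_def by force
    then show "A = D * (D\<^sup>2 - 1)" unfolding A target by (intro sum.cong) auto
  qed
qed

end

section \<open>The index as a weighted sum of cuts\<close>

lemma degree_eq: "degree G v = card (parcs G `` {v})"
proof -
  have "out_arcs (with_proj G) v = Pair v ` (parcs G `` {v})" by (auto simp: out_arcs_def)
  then show ?thesis by (simp add: degree_def out_degree_def card_image inj_on_def)
qed

lemma sum_edges_doubled:
  assumes "pair_graph G" and sym_f: "\<And>u v. f u v = f v u"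
  shows "2 * (\<Sum>e\<in>edges G. on_edge f e) = (\<Sum>(u, v)\<in>parcs G. f u v :: int)"
proof -
  interpret pair_graph G by fact
  let ?edge = "\<lambda>(u, v). {u, v}"
  have edges: "edges G = ?edge ` parcs G" by (auto simp: edges_def)
  have "(\<Sum>(u, v)\<in>{a \<in> parcs G. ?edge a = e}. f u v) = 2 * on_edge f e" if "e \<in> edges G" for e
  proof -
    from that obtain u v where uv: "(u, v) \<in> parcs G" "e = {u, v}" by (auto simp: edges_def)
    then have "u \<noteq> v" "(v, u) \<in> parcs G" using no_loops' arcs_symmetric by auto
    with uv have "{a \<in> parcs G. ?edge a = e} = {(u, v), (v, u)}"
      by (auto simp: doubleton_eq_iff)
    then show ?thesis
      using \<open>u \<noteq> v\<close> uv sym_f[of u v] on_edge_insert[of f u v, OF sym_f] by simp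
  qed
  then show ?thesis
    using sum.image_gen[OF pair_finite_arcs, of "\<lambda>(u, v). f u v" ?edge]
    by (simp add: edges sum_distrib_left)
qed

text \<open>
  The square \<open>n\<^sup>2\<close> is the sum of the first \<open>n\<close> odd numbers, so the difference of two squares is a sum of
  consecutive odd numbers. Only one of the two indicators can be nonzero; the symmetric form is the
  one that can be summed over both orientations of an edge.
\<close>
lemma abs_diff_squares_layers:
  assumes "a \<le> m" "b \<le> m"
  shows "\<bar>(int a)\<^sup>2 - (int b)\<^sup>2\<bar> =
    (\<Sum>k<m. int (2 * k + 1) * (of_bool (b \<le> k \<and> k < a) + of_bool (a \<le> k \<and> k < b)))"
  using assms
proof (induction a b rule: linorder_wlog)
  case (le a b)
  have square: "(\<Sum>k<n. int (2 * k + 1)) = (int n)\<^sup>2" for n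
    by (induction n) (auto simp: power2_eq_square algebra_simps)
  have "(\<Sum>k<m. int (2 * k + 1) * (of_bool (b \<le> k \<and> k < a) + of_bool (a \<le> k \<and> k < b))) =
    (\<Sum>k\<in>{a..<b}. int (2 * k + 1))"
    using le by (intro sum.mono_neutral_cong_right) auto
  also have "\<dots> = (int b)\<^sup>2 - (int a)\<^sup>2"
    using sum_diff_nat_ivl[of 0 a b "\<lambda>k. int (2 * k + 1)"] le square by (simp add: lessThan_atLeast0)
  also have "\<dots> = \<bar>(int a)\<^sup>2 - (int b)\<^sup>2\<bar>" using le by (simp add: power_mono)
  finally show ?case by simp
next
  case (sym a b)
  then show ?case by (simp add: abs_minus_commute add.commute)
qed

text \<open>
  After exchanging the sums, the two indicators count the arcs that leave the level set and those that
  enter it. Reversing arcs shows that both counts agree, which cancels the factor 2 between arcs and edges.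
\<close>
lemma modified_albertson_layers:
  assumes "pair_graph G" and deg_le: "\<And>v. v \<in> pverts G \<Longrightarrow> degree G v \<le> m"
  shows "modified_albertson G =
    (\<Sum>k<m. int (2 * k + 1) * int (card (parcs G \<inter> {v. k < degree G v} \<times> - {v. k < degree G v})))"
proof -
  interpret pair_graph G by fact
  let ?d = "degree G"
  let ?S = "\<lambda>k. {v. k < ?d v}"
  have "2 * modified_albertson G = (\<Sum>(u, v)\<in>parcs G. \<bar>(int (?d u))\<^sup>2 - (int (?d v))\<^sup>2\<bar>)"
    unfolding modified_albertson_def
    by (rule sum_edges_doubled) (auto simp: assms(1) abs_minus_commute)
  also have "\<dots> = (\<Sum>(u, v)\<in>parcs G. \<Sum>k<m. int (2 * k + 1) *
      (of_bool ((u, v) \<in> ?S k \<times> - ?S k) + of_bool ((v, u) \<in> ?S k \<times> - ?S k)))"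
  proof (intro sum.cong refl, clarify)
    fix u v assume "(u, v) \<in> parcs G"
    then have "?d u \<le> m" "?d v \<le> m" using deg_le in_arcsD1 in_arcsD2 by auto
    from abs_diff_squares_layers[OF this] show "\<bar>(int (?d u))\<^sup>2 - (int (?d v))\<^sup>2\<bar> =
      (\<Sum>k<m. int (2 * k + 1) * (of_bool ((u, v) \<in> ?S k \<times> - ?S k) + of_bool ((v, u) \<in> ?S k \<times> - ?S k)))"
      by (simp add: not_less conj_commute)
  qed
  also have "\<dots> = (\<Sum>k<m. int (2 * k + 1) * ((\<Sum>a\<in>parcs G. of_bool (a \<in> ?S k \<times> - ?S k)) +
      (\<Sum>a\<in>parcs G. of_bool (prod.swap a \<in> ?S k \<times> - ?S k))))"
    unfolding case_prod_unfold prod.collapse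
    by (subst sum.swap) (simp only: sum.distrib prod.swap_def flip: sum_distrib_left)
  also have "\<dots> = (\<Sum>k<m. int (2 * k + 1) * (2 * int (card (parcs G \<inter> ?S k \<times> - ?S k))))"
  proof -
    have swap: "prod.swap ` parcs G = parcs G"
      using arcs_symmetric by (force simp: image_iff)
    have "(\<Sum>a\<in>parcs G. of_bool (prod.swap a \<in> X) :: int) = (\<Sum>a\<in>parcs G. of_bool (a \<in> X))" for X
      using sum.reindex[of prod.swap "parcs G" "\<lambda>a. of_bool (a \<in> X) :: int"] by (simp add: swap)
    then show ?thesis using pair_finite_arcs by (simp only: sum_of_bool_eq) (simp add: Int_def)
  qed
  also have "\<dots> = 2 * (\<Sum>k<m. int (2 * k + 1) * int (card (parcs G \<inter> ?S k \<times> - ?S k)))"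
    by (simp add: sum_distrib_left mult.left_commute)
  finally show ?thesis by simp
qed

section \<open>From the graph predicates to the arc relation\<close>

lemma awalk_of_path:
  assumes "successively (\<lambda>x y. (x, y) \<in> E) (x # xs)"
  shows "pcas x (vwalk_arcs (x # xs)) (last (x # xs))"
    and "pawalk_verts x (vwalk_arcs (x # xs)) = x # xs"
    and "set (vwalk_arcs (x # xs)) \<subseteq> E"
  using assms by (induction xs arbitrary: x) auto

lemma undirected_tree_imp_tree_arcs:
  assumes "undirected_tree T"
  shows "tree_arcs (pverts T) (parcs T)"
proof -
  from assms have "pair_graph T" and conn: "connected (with_proj T)"
    and no_cycle: "\<And>p. pre_digraph.cycle (with_proj T) p \<Longrightarrow> length p < 3"
    by (auto simp: undirected_tree_def not_le[symmetric])
  interpret pair_graph T by fact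
  have sym: "sym (parcs T)" using arcs_symmetric by (auto simp: sym_def)
  have sc: "strongly_connected (with_proj T)"
    using symmetric_connected_imp_strongly_connected conn pair_sym_arcs by blast
  show ?thesis
  proof
    show "finite (pverts T)" by simp
    show "pverts T \<noteq> {}" using sc by (simp add: strongly_connected_def)
    show "parcs T \<subseteq> pverts T \<times> pverts T" using in_arcsD1 in_arcsD2 by auto
    show "sym (parcs T)" by (fact sym)
    show "irrefl (parcs T)" using no_loops' by (auto simp: irrefl_def)
    show "parcs T \<inter> A \<times> (pverts T - A) \<noteq> {}" if A: "A \<subset> pverts T" "A \<noteq> {}" for A
    proof
      assume closed: "parcs T \<inter> A \<times> (pverts T - A) = {}"
      obtain u v where uv: "u \<in> A" "v \<in> pverts T" "v \<notin> A" using A by auto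
      then have "u \<rightarrow>\<^sup>*\<^bsub>with_proj T\<^esub> v" using sc A by (auto simp: strongly_connected_def)
      then have "v \<in> A"
        by (induction rule: reachable_induct) (use uv closed in_arcsD2 in auto)
      with uv show False by simp
    qed
    show "cycle_free (parcs T)"
      unfolding cycle_free_def
    proof
      assume "\<exists>xs. distinct xs \<and> length xs \<ge> 3 \<and>
        successively (\<lambda>x y. (x, y) \<in> parcs T) xs \<and> (last xs, hd xs) \<in> parcs T"
      then obtain x ys where xs: "distinct (x # ys)" "length (x # ys) \<ge> 3"
        "successively (\<lambda>x y. (x, y) \<in> parcs T) (x # ys)" "(last (x # ys), x) \<in> parcs T"
        by (metis list.exhaust_sel list.size(3) not_numeral_le_zero)
      \<comment> \<open>Returning to the start of the path gives a closed walk that repeats only its end point.\<close>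
      let ?p = "vwalk_arcs (x # ys @ [x])"
      have "successively (\<lambda>x y. (x, y) \<in> parcs T) (x # ys @ [x])"
        using xs(3,4) successively_append_iff[of _ "x # ys" "[x]"] by simp
      note walk = awalk_of_path[OF this]
      have "length ?p = Suc (length ys)" using vwalk_length_simp[of "x # ys @ [x]"] unfolding vwalk_length_def by simp
      moreover have "cycle ?p"
        unfolding cycle_def awalk_def
        using walk xs in_arcsD2 \<open>length ?p = Suc (length ys)\<close> by (intro exI[of _ x]) auto
      ultimately show False using no_cycle[of ?p] xs(2) by simp
    qed
  qed
qed

section \<open>Isomorphisms\<close>

lemma digraph_iso_degree:
  assumes "digraph_iso (with_proj G) (with_proj H)"
  obtains f where "bij_betw f (pverts G) (pverts H)"
    "\<And>v. v \<in> pverts G \<Longrightarrow> degree H (f v) = degree G v"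
proof -
  obtain h where h: "pre_digraph.digraph_isomorphism (with_proj G) h" "with_proj H = app_iso h (with_proj G)"
    using assms by (auto simp: digraph_iso_def)
  then have wf: "wf_digraph (with_proj G)" by (simp add: pre_digraph.digraph_isomorphism_def)
  have "pverts H = iso_verts h ` pverts G" using arg_cong[OF h(2), of verts] by simp
  moreover have "inj_on (iso_verts h) (pverts G)"
    using h(1) by (simp add: pre_digraph.digraph_isomorphism_def)
  moreover have "degree H (iso_verts h v) = degree G v" if "v \<in> pverts G" for v
    using wf_digraph.out_degree_app_iso_eq[OF wf h(1)] that by (simp add: degree_def h(2))
  ultimately show ?thesis by (intro that[of "iso_verts h"]) (auto simp: bij_betw_def)
qed

lemma degree_path_graph_le: "degree (path_graph n) i \<le> 2"
proof -
  have "parcs (path_graph n) `` {i} \<subseteq> {Suc i, i - 1}" by (auto simp: path_graph_def)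
  then have "card (parcs (path_graph n) `` {i}) \<le> card {Suc i, i - 1}" by (intro card_mono) auto
  also have "\<dots> \<le> 2" by (simp add: card_insert_if)
  finally show ?thesis by (simp add: degree_eq)
qed

lemma digraph_iso_refl:
  assumes "pair_wf_digraph G"
  shows "digraph_iso (with_proj G) (with_proj G)"
proof -
  let ?h = "\<lparr>iso_verts = id, iso_arcs = id, iso_head = snd, iso_tail = fst\<rparr>"
  have "pre_digraph.digraph_isomorphism (with_proj G) ?h"
    using assms by (simp add: pre_digraph.digraph_isomorphism_def wf_digraph_wp_iff)
  moreover have "with_proj G = app_iso ?h (with_proj G)" by (simp add: app_iso_def with_proj_def)
  ultimately show ?thesis unfolding digraph_iso_def by blast
qed

text \<open>
  The isomorphism sends every vertex to its position in \<open>xs\<close>.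
\<close>
lemma digraph_iso_path_graphI:
  assumes "pair_wf_digraph G" "distinct xs" "set xs = pverts G"
    and arcs: "parcs G = {(xs ! i, xs ! j) | i j. i < length xs \<and> j < length xs \<and> (j = Suc i \<or> i = Suc j)}"
  shows "digraph_iso (with_proj G) (with_proj (path_graph (length xs)))"
proof -
  let ?ix = "the_inv_into {..<length xs} (\<lambda>i. xs ! i)"
  have inj: "inj_on (\<lambda>i. xs ! i) {..<length xs}" using assms(2) by (simp add: inj_on_nth)
  have ix: "?ix (xs ! i) = i" if "i < length xs" for i
    using the_inv_into_f_f[OF inj] that by simp
  have verts: "pverts G = (\<lambda>i. xs ! i) ` {..<length xs}"
    unfolding assms(3)[symmetric] set_conv_nth by auto
  let ?h = "\<lparr>iso_verts = ?ix, iso_arcs = map_prod ?ix ?ix, iso_head = snd, iso_tail = fst\<rparr>"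
  have "inj_on ?ix (pverts G)" unfolding verts by (auto simp: inj_on_def ix)
  moreover have "inj_on (map_prod ?ix ?ix) (parcs G)"
    using pair_wf_digraph.wellformed'[OF assms(1)]
    by (intro inj_on_subset[OF map_prod_inj_on[OF \<open>inj_on ?ix (pverts G)\<close> \<open>inj_on ?ix (pverts G)\<close>]])
      (auto simp del: with_proj_simps)
  ultimately have "pre_digraph.digraph_isomorphism (with_proj G) ?h"
    using assms(1) by (simp add: pre_digraph.digraph_isomorphism_def wf_digraph_wp_iff)
  moreover have "with_proj (path_graph (length xs)) = app_iso ?h (with_proj G)"
  proof -
    have "?ix ` pverts G = {..<length xs}" unfolding verts image_image by (simp add: ix)
    moreover have "map_prod ?ix ?ix ` parcs G =
      {(i, j). i < length xs \<and> j < length xs \<and> (j = Suc i \<or> i = Suc j)}"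
    proof -
      have "parcs G = (\<lambda>(i, j). (xs ! i, xs ! j)) `
        {(i, j). i < length xs \<and> j < length xs \<and> (j = Suc i \<or> i = Suc j)}"
        unfolding arcs by auto
      then show ?thesis by (simp add: image_image case_prod_unfold ix cong: image_cong_simp)
    qed
    ultimately show ?thesis by (simp add: app_iso_def with_proj_def path_graph_def)
  qed
  ultimately show ?thesis unfolding digraph_iso_def by blast
qed

text \<open>
  If \<open>w\<close> has degree at most 2 the tree is a path, and otherwise \<open>w\<close> is its unique branching vertex. In the
  other direction, a second vertex \<open>u\<close> of degree greater than 2 forces \<open>w\<close> to have degree greater than 2
  too, by maximality, and an isomorphism maps the two to distinct branching vertices.
\<close>
lemma path_or_single_branching_iff:
  fixes T :: "'a pair_pre_digraph"
  assumes T: "undirected_tree T" and w: "w \<in> pverts T"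
    and max: "\<And>v. v \<in> pverts T \<Longrightarrow> degree T v \<le> degree T w"
  shows "(\<forall>u\<in>pverts T. u \<noteq> w \<longrightarrow> degree T u \<le> 2) \<longleftrightarrow>
    (\<exists>n\<ge>1. digraph_iso (with_proj T) (with_proj (path_graph n))) \<or>
    (\<exists>S :: 'a pair_pre_digraph. undirected_tree S \<and>
       (\<exists>!v. v \<in> pverts S \<and> degree S v > 2) \<and>
       digraph_iso (with_proj T) (with_proj S))"
    (is "?L \<longleftrightarrow> ?path \<or> ?branch")
proof -
  interpret tree_arcs "pverts T" "parcs T"
    by (rule undirected_tree_imp_tree_arcs[OF T])
  have wf: "pair_wf_digraph T"
    using T by (simp add: undirected_tree_def pair_digraph.pair_wf_digraph pair_graph_def)
  show ?thesis
  proof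
    assume L: ?L
    show "?path \<or> ?branch"
    proof (cases "degree T w \<le> 2")
      case True
      then have "deg v \<le> 2" if "v \<in> pverts T" for v
        using max[OF that] by (simp add: degree_eq)
      then obtain xs where "distinct xs" "set xs = pverts T"
        "parcs T = {(xs ! i, xs ! j) | i j. i < length xs \<and> j < length xs \<and> (j = Suc i \<or> i = Suc j)}"
        by (rule path_if_deg_le_2)
      from digraph_iso_path_graphI[OF wf this]
      have "digraph_iso (with_proj T) (with_proj (path_graph (length xs)))" .
      moreover have "length xs \<ge> 1" using \<open>set xs = pverts T\<close> V_nonempty by (cases xs) auto
      ultimately show ?thesis by blast
    next
      case False
      then have "\<exists>!v. v \<in> pverts T \<and> degree T v > 2" using w L by (metis not_le)
      then show ?thesis using T digraph_iso_refl[OF wf] by blast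
    qed
  next
    assume "?path \<or> ?branch"
    then show ?L
    proof
      assume ?path
      then obtain n where "digraph_iso (with_proj T) (with_proj (path_graph n))" by blast
      then show ?L by (metis digraph_iso_degree degree_path_graph_le)
    next
      assume ?branch
      then obtain S :: "'a pair_pre_digraph" where
        one: "\<exists>!v. v \<in> pverts S \<and> degree S v > 2" and iso: "digraph_iso (with_proj T) (with_proj S)"
        by blast
      obtain f where f: "bij_betw f (pverts T) (pverts S)"
        "\<And>v. v \<in> pverts T \<Longrightarrow> degree S (f v) = degree T v"
        using digraph_iso_degree[OF iso] by blast
      show ?L
      proof (intro ballI impI, rule ccontr)
        fix u assume u: "u \<in> pverts T" "u \<noteq> w" "\<not> degree T u \<le> 2"
        then have "degree S (f u) > 2" "degree S (f w) > 2" using f w max[of u] by auto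
        moreover have "f u \<in> pverts S" "f w \<in> pverts S" using f(1) u w by (auto simp: bij_betw_def)
        ultimately have "f u = f w" using one by blast
        then show False using f(1) u w by (auto simp: bij_betw_def inj_on_def)
      qed
    qed
  qed
qed

section \<open>The lower bound and the extremal trees\<close>

theorem proposition2p1:
  fixes T :: "'a pair_pre_digraph" and \<Delta> :: int
  assumes "undirected_tree T"
    and "\<Delta> = int (max_degree T)"
  shows "modified_albertson T \<ge> \<Delta> * (\<Delta>\<^sup>2 - 1) \<and>
    (modified_albertson T = \<Delta> * (\<Delta>\<^sup>2 - 1) \<longleftrightarrow>
      (\<exists>n\<ge>1. digraph_iso (with_proj T) (with_proj (path_graph n))) \<or>
      (\<exists>S :: 'a pair_pre_digraph. undirected_tree S \<and>
         (\<exists>!v. v \<in> pverts S \<and> degree S v > 2) \<and>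
         digraph_iso (with_proj T) (with_proj S)))"
proof -
  interpret tree_arcs "pverts T" "parcs T"
    by (rule undirected_tree_imp_tree_arcs[OF assms(1)])
  have "max_degree T \<in> degree T ` pverts T"
    unfolding max_degree_def using finite_V V_nonempty by (intro Max_in) auto
  then obtain w where w: "w \<in> pverts T" "degree T w = max_degree T" by auto
  have max: "degree T v \<le> degree T w" if "v \<in> pverts T" for v
    using that w finite_V by (simp add: max_degree_def)
  have "modified_albertson T = (\<Sum>k<deg w. int (2 * k + 1) * cut k)"
    using modified_albertson_layers[of T "deg w"] max assms(1)
    by (simp add: degree_eq undirected_tree_def)
  moreover have "\<Delta> = int (deg w)" using assms(2) w by (simp add: degree_eq)
  moreover have "deg v \<le> deg w" if "v \<in> pverts T" for v
    using max[OF that] by (simp add: degree_eq)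
  moreover note weighted_cuts[OF w(1) this]
    path_or_single_branching_iff[OF assms(1) w(1) max, unfolded degree_eq]
  ultimately show ?thesis by (simp only: degree_eq)
qed

end
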